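(* For any positive integer $\mathsf n$, any access structure $(\mathfrak A,\mathfrak B)$ on $[\mathsf n]$ with $\mathfrak A,\mathfrak B\ne\emptyset$, and any integer $\mathsf f\ge2$, there exists an $(\mathfrak A,\mathfrak B,\mathsf n,\mathsf f)$-CSSPIR protocol.
   Context: Notation: $[n]=\{1,\dots,n\}$; for a tuple $A=(A_1,\dots,A_n)$ and $\mathcal X\subset[n]$, $A_{\mathcal X}=(A_i)_{i\in\mathcal X}$. $I(\cdot;\cdot)$ is mutual information. Access structure on $[\mathsf n]$: a pair $(\mathfrak A,\mathfrak B)$ of subsets of $2^{[\mathsf n]}$ with $\mathfrak A$ closed under supersets, $\mathfrak B$ closed under subsets, and $\mathfrak A\cap\mathfrak B=\emptyset$. SPIR protocol ($\mathsf n$ servers, $\mathsf f$ files). Data: finite sets $\mathcal M$ (files, $|\mathcal M|\ge2$), $\mathcal U$ (random seeds), $\mathcal R$ (user randomness), $\mathcal T_j,\mathcal Q_j,\mathcal D_j$ ($j\in[\mathsf n]$), and deterministic maps $h:\mathcal U\to\prod_j\mathcal T_j$, $\phi:[\mathsf f]\times\mathcal R\to\prod_j\mathcal Q_j$, $g_j:\mathcal Q_j\times\mathcal M^{\mathsf f}\times\mathcal T_j\to\mathcal D_j$. The random variables $M=(M_1,\dots,M_{\mathsf f})\in\mathcal M^{\mathsf f}$, $U\in\mathcal U$, $K\in[\mathsf f]$, $R\in\mathcal R$ are uniform and mutually independent; $T=h(U)$, $Q=\phi(K,R)$, $D_j=g_j(Q_j,M,T_j)$, $D=(D_1,\dots,D_{\mathsf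 n})$. It is an $(\mathfrak A,\mathfrak B,\mathsf n,\mathsf f)$-CSSPIR protocol (completely secure SPIR) if: - Correctness: for all $r\in\mathcal R$, $k\in[\mathsf f]$, $\mathcal A\in\mathfrak A$, given $K=k,R=r$ the maximum likelihood decoder of $M_k$ from $D_{\mathcal A}$ has error probability $0$ (i.e. $M_k$ is a function of $D_{\mathcal A}$). - Server secrecy: $I(D;M_{[\mathsf f]\setminus\{k\}}\mid R=r,K=k)=0$ for all $r,k$. - User secrecy: $I(K;Q_{\mathcal B})=0$ for all $\mathcal B\in\mathfrak B$. *)

theory Defs
  imports "HOL-Probability.Probability"
begin

definition access_structure :: "nat \<Rightarrow> nat set set \<Rightarrow> nat set set \<Rightarrow> bool" where
  "access_structure n \<AA> \<BB> \<longleftrightarrow>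
     \<AA> \<subseteq> Pow {1..n} \<and> \<BB> \<subseteq> Pow {1..n} \<and>
     (\<forall>A\<in>\<AA>. \<forall>A'. A \<subseteq> A' \<and> A' \<subseteq> {1..n} \<longrightarrow> A' \<in> \<AA>) \<and>
     (\<forall>B\<in>\<BB>. \<forall>B'. B' \<subseteq> B \<longrightarrow> B' \<in> \<BB>) \<and>
     \<AA> \<inter> \<BB> = {}"

(* Tuples indexed by [n] or [f] are extensional functions on {1..n} or {1..f}. *)

(* Every finite set is in bijection with a finite set of naturals, so instantiating all alphabet
   types to nat covers all protocols up to renaming of the alphabets. *)

record ('m, 'u, 'r, 't, 'q, 'd) spir =
  file_set :: "'m set"
  seed_set :: "'u set"
  user_rand_set :: "'r set"
  share_set :: "nat \<Rightarrow> 't set"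
  query_set :: "nat \<Rightarrow> 'q set"
  answer_set :: "nat \<Rightarrow> 'd set"
  share_map :: "'u \<Rightarrow> nat \<Rightarrow> 't"                                (* h *)
  query_map :: "nat \<times> 'r \<Rightarrow> nat \<Rightarrow> 'q"                         (* phi *)
  answer_map :: "nat \<Rightarrow> 'q \<times> (nat \<Rightarrow> 'm) \<times> 't \<Rightarrow> 'd"           (* g_j *)

definition spir_protocol :: "nat \<Rightarrow> nat \<Rightarrow> ('m, 'u, 'r, 't, 'q, 'd) spir \<Rightarrow> bool" where
  "spir_protocol n f P \<longleftrightarrow>
     finite (file_set P) \<and> 2 \<le> card (file_set P) \<and>
     finite (seed_set P) \<and> seed_set P \<noteq> {} \<and>
     finite (user_rand_set P) \<and> user_rand_set P \<noteq> {} \<and>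
     (\<forall>j\<in>{1..n}. finite (share_set P j) \<and> finite (query_set P j) \<and> finite (answer_set P j)) \<and>
     share_map P \<in> seed_set P \<rightarrow> (\<Pi>\<^sub>E j\<in>{1..n}. share_set P j) \<and>
     query_map P \<in> {1..f} \<times> user_rand_set P \<rightarrow> (\<Pi>\<^sub>E j\<in>{1..n}. query_set P j) \<and>
     (\<forall>j\<in>{1..n}. answer_map P j \<in>
        query_set P j \<times> (\<Pi>\<^sub>E i\<in>{1..f}. file_set P) \<times> share_set P j \<rightarrow> answer_set P j)"

text \<open>
  An outcome is a quadruple (M, U, K, R). The uniform distribution on the product set says
  exactly that M, U, K, R are uniform and mutually independent.
\<close>

type_synonym ('m, 'u, 'r) outcome = "(nat \<Rightarrow> 'm) \<times> 'u \<times> nat \<times> 'r"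

definition spir_space ::
  "nat \<Rightarrow> ('m, 'u, 'r, 't, 'q, 'd) spir \<Rightarrow> ('m, 'u, 'r) outcome measure" where
  "spir_space f P = uniform_count_measure
     ((\<Pi>\<^sub>E i\<in>{1..f}. file_set P) \<times> seed_set P \<times> {1..f} \<times> user_rand_set P)"

fun rv_M :: "('m, 'u, 'r) outcome \<Rightarrow> nat \<Rightarrow> 'm" where "rv_M (m, u, k, r) = m"
fun rv_U :: "('m, 'u, 'r) outcome \<Rightarrow> 'u" where "rv_U (m, u, k, r) = u"
fun rv_K :: "('m, 'u, 'r) outcome \<Rightarrow> nat" where "rv_K (m, u, k, r) = k"
fun rv_R :: "('m, 'u, 'r) outcome \<Rightarrow> 'r" where "rv_R (m, u, k, r) = r"

definition rv_T ::
  "('m, 'u, 'r, 't, 'q, 'd) spir \<Rightarrow> ('m, 'u, 'r) outcome \<Rightarrow> nat \<Rightarrow> 't" where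
  "rv_T P \<omega> = share_map P (rv_U \<omega>)"

definition rv_Q ::
  "('m, 'u, 'r, 't, 'q, 'd) spir \<Rightarrow> ('m, 'u, 'r) outcome \<Rightarrow> nat \<Rightarrow> 'q" where
  "rv_Q P \<omega> = query_map P (rv_K \<omega>, rv_R \<omega>)"

definition rv_D ::
  "('m, 'u, 'r, 't, 'q, 'd) spir \<Rightarrow> ('m, 'u, 'r) outcome \<Rightarrow> nat \<Rightarrow> 'd" where
  "rv_D P \<omega> j = answer_map P j (rv_Q P \<omega> j, rv_M \<omega>, rv_T P \<omega> j)"

text \<open>
  The maximum likelihood decoder of \<open>M\<^sub>k\<close> from \<open>D\<^sub>A\<close> given \<open>K = k\<close> and \<open>R = r\<close>
  (ties are broken by the choice operator inside \<^const>\<open>arg_max_on\<close>).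
\<close>

definition ml_decoder ::
  "nat \<Rightarrow> ('m, 'u, 'r, 't, 'q, 'd) spir \<Rightarrow> nat set \<Rightarrow> nat \<Rightarrow> 'r \<Rightarrow> (nat \<Rightarrow> 'd) \<Rightarrow> 'm" where
  "ml_decoder f P A k r d =
     arg_max_on
       (\<lambda>m. \<P>(\<omega> in spir_space f P. restrict (rv_D P \<omega>) A = d
              \<bar> rv_M \<omega> k = m \<and> rv_K \<omega> = k \<and> rv_R \<omega> = r))
       (file_set P)"

definition spir_correct ::
  "nat set set \<Rightarrow> nat \<Rightarrow> ('m, 'u, 'r, 't, 'q, 'd) spir \<Rightarrow> bool" where
  "spir_correct \<AA> f P \<longleftrightarrow>
     (\<forall>r\<in>user_rand_set P. \<forall>k\<in>{1..f}. \<forall>A\<in>\<AA>.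
        \<P>(\<omega> in spir_space f P. ml_decoder f P A k r (restrict (rv_D P \<omega>) A) \<noteq> rv_M \<omega> k
           \<bar> rv_K \<omega> = k \<and> rv_R \<omega> = r) = 0)"

text \<open>
  Mutual information, in bits, of two random variables with finite range. This is the
  abbreviation \<open>mutual_information_Pow\<close> of the locale \<^locale>\<open>information_space\<close>,
  made available for an explicitly given probability space.
\<close>

definition mutual_info :: "'a measure \<Rightarrow> ('a \<Rightarrow> 'b) \<Rightarrow> ('a \<Rightarrow> 'c) \<Rightarrow> real" where
  "mutual_info M X Y =
     prob_space.mutual_information M 2 (count_space (X ` space M)) (count_space (Y ` space M)) X Y"

text \<open>\<open>I(D; M\<^bsub>[f]\<setminus>{k}\<^esub> | R = r, K = k)\<close> is taken in the space conditioned on \<open>R = r, K = k\<close>.\<close>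

definition server_secret ::
  "nat \<Rightarrow> nat \<Rightarrow> ('m, 'u, 'r, 't, 'q, 'd) spir \<Rightarrow> bool" where
  "server_secret n f P \<longleftrightarrow>
     (\<forall>r\<in>user_rand_set P. \<forall>k\<in>{1..f}.
        mutual_info
          (uniform_measure (spir_space f P) {\<omega> \<in> space (spir_space f P). rv_R \<omega> = r \<and> rv_K \<omega> = k})
          (\<lambda>\<omega>. restrict (rv_D P \<omega>) {1..n})
          (\<lambda>\<omega>. restrict (rv_M \<omega>) ({1..f} - {k})) = 0)"

definition user_secret ::
  "nat set set \<Rightarrow> nat \<Rightarrow> ('m, 'u, 'r, 't, 'q, 'd) spir \<Rightarrow> bool" where
  "user_secret \<BB> f P \<longleftrightarrow>
     (\<forall>B\<in>\<BB>. mutual_info (spir_space f P) rv_K (\<lambda>\<omega>. restrict (rv_Q P \<omega>) B) = 0)"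

definition csspir_protocol ::
  "nat set set \<Rightarrow> nat set set \<Rightarrow> nat \<Rightarrow> nat \<Rightarrow> ('m, 'u, 'r, 't, 'q, 'd) spir \<Rightarrow> bool" where
  "csspir_protocol \<AA> \<BB> n f P \<longleftrightarrow>
     spir_protocol n f P \<and> spir_correct \<AA> f P \<and> server_secret n f P \<and> user_secret \<BB> f P"

end

theory Submission
  imports Defs
begin

text \<open>
  Work over the field with two elements. For every \<open>A \<in> \<AA>\<close> separately, the user shares the unit
  vector \<open>e\<^sub>k\<close> additively among the servers in \<open>A\<close>; server \<open>j\<close> answers with the inner product of
  its share and the files, masked by its share in an additive sharing of zero that the servers
  hold for \<open>A\<close>. The answers of \<open>A\<close> sum to \<open>M\<^sub>k\<close>. Adding a sharing of zero to the servers' randomness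
  absorbs any change of the files other than \<open>M\<^sub>k\<close>. No \<open>B \<in> \<BB>\<close> contains a set of \<open>\<AA>\<close>, so
  a change of \<open>k\<close> is absorbed by changing the share of one server in \<open>A - B\<close> for each \<open>A\<close>.
  As all these changes are bijections of uniform spaces, the independence claims follow by counting.
\<close>

section \<open>Independence and mutual information on finite spaces\<close>

text \<open>Mutual information is the Kullback-Leibler divergence of the joint law from the product
  of the marginals. The product formula at every pair of values makes these two measures coincide,
  and a measure has divergence zero from itself.\<close>

lemma mutual_info_eq_0:
  assumes "prob_space M" and sets: "sets M = Pow (space M)" and fin: "finite (space M)"
    and indep: "\<And>x y. measure M {\<omega> \<in> space M. X \<omega> = x \<and> Y \<omega> = y} =
      measure M {\<omega> \<in> space M. X \<omega> = x} * measure M {\<omega> \<in> space M. Y \<omega> = y}"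
  shows "mutual_info M X Y = 0"
proof -
  interpret prob_space M by fact
  let ?S = "count_space (X ` space M)" and ?T = "count_space (Y ` space M)"
  have X: "X \<in> measurable M ?S" and Y: "Y \<in> measurable M ?T"
    unfolding measurable_def using sets by auto
  interpret X: prob_space "distr M ?S X" by (rule prob_space_distr[OF X])
  interpret Y: prob_space "distr M ?T Y" by (rule prob_space_distr[OF Y])
  interpret XY: pair_prob_space "distr M ?S X" "distr M ?T Y" ..
  \<comment> \<open>Both ranges are finite, so the product sigma-algebra is discrete and equality of
    measures can be checked on singletons.\<close>
  have ST: "?S \<Otimes>\<^sub>M ?T = count_space (X ` space M \<times> Y ` space M)"
    using fin by (intro pair_measure_countable countable_finite) auto
  have XYm: "(\<lambda>\<omega>. (X \<omega>, Y \<omega>)) \<in> measurable M (?S \<Otimes>\<^sub>M ?T)"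
    using X Y by (rule measurable_Pair)
  have "distr M ?S X \<Otimes>\<^sub>M distr M ?T Y = distr M (?S \<Otimes>\<^sub>M ?T) (\<lambda>\<omega>. (X \<omega>, Y \<omega>))"
  proof (rule measure_eqI_finite[where A = "X ` space M \<times> Y ` space M"])
    have "sets (distr M ?S X \<Otimes>\<^sub>M distr M ?T Y) = sets (?S \<Otimes>\<^sub>M ?T)"
      by (rule sets_pair_measure_cong) simp_all
    then show "sets (distr M ?S X \<Otimes>\<^sub>M distr M ?T Y) = Pow (X ` space M \<times> Y ` space M)"
      by (simp only: ST sets_count_space)
    show "sets (distr M (?S \<Otimes>\<^sub>M ?T) (\<lambda>\<omega>. (X \<omega>, Y \<omega>))) = Pow (X ` space M \<times> Y ` space M)"
      by (simp only: ST sets_distr sets_count_space)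
    show "finite (X ` space M \<times> Y ` space M)"
      using fin by simp
  next
    fix a assume "a \<in> X ` space M \<times> Y ` space M"
    then obtain x y where a: "a = (x, y)" and x: "x \<in> X ` space M" and y: "y \<in> Y ` space M"
      by auto
    have "emeasure (distr M ?S X \<Otimes>\<^sub>M distr M ?T Y) {a} =
        emeasure (distr M ?S X) {x} * emeasure (distr M ?T Y) {y}"
      using x y by (subst Y.emeasure_pair_measure_Times[symmetric]) (auto simp: a)
    also have "\<dots> = emeasure M {\<omega> \<in> space M. X \<omega> = x} * emeasure M {\<omega> \<in> space M. Y \<omega> = y}"
      using x y by (simp add: emeasure_distr[OF X] emeasure_distr[OF Y] vimage_def Int_def conj_commute)
    also have "\<dots> = emeasure M {\<omega> \<in> space M. X \<omega> = x \<and> Y \<omega> = y}"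
      by (simp add: emeasure_eq_measure indep ennreal_mult)
    also have "\<dots> = emeasure (distr M (?S \<Otimes>\<^sub>M ?T) (\<lambda>\<omega>. (X \<omega>, Y \<omega>))) {a}"
    proof -
      have "{a} \<in> sets (?S \<Otimes>\<^sub>M ?T)"
        unfolding ST using x y by (simp add: a)
      moreover have "(\<lambda>\<omega>. (X \<omega>, Y \<omega>)) -` {a} \<inter> space M = {\<omega> \<in> space M. X \<omega> = x \<and> Y \<omega> = y}"
        by (auto simp: a)
      ultimately show ?thesis
        by (simp add: emeasure_distr[OF XYm])
    qed
    finally show "emeasure (distr M ?S X \<Otimes>\<^sub>M distr M ?T Y) {a} =
        emeasure (distr M (?S \<Otimes>\<^sub>M ?T) (\<lambda>\<omega>. (X \<omega>, Y \<omega>))) {a}" .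
  qed
  then show ?thesis
    unfolding mutual_info_def mutual_information_def by (metis XY.KL_same_eq_0)
qed

text \<open>User secrecy is unconditional. Conditioning on the whole space changes nothing, so it
  falls under the same criterion as the conditioned server secrecy.\<close>

lemma uniform_measure_uniform_count_measure:
  assumes "finite A" "A \<noteq> {}"
  shows "uniform_measure (uniform_count_measure A) A = uniform_count_measure A"
proof (rule measure_eqI)
  interpret prob_space "uniform_count_measure A"
    using assms by (rule prob_space_uniform_count_measure)
  fix E assume "E \<in> sets (uniform_measure (uniform_count_measure A) A)"
  then have E: "E \<subseteq> A" by (simp add: sets_uniform_count_measure)
  have "emeasure (uniform_count_measure A) A = 1"
    using emeasure_space_1 by (simp add: space_uniform_count_measure)
  then show "emeasure (uniform_measure (uniform_count_measure A) A) E =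
      emeasure (uniform_count_measure A) E"
    using E by (simp add: sets_uniform_count_measure Int_absorb1 divide_ennreal_def)
qed simp

text \<open>Conditioning a uniform space on \<open>W\<close> gives the uniform law on
  \<open>W\<close>, so probabilities are quotients of cardinalities. The hypothesis is independence
  with the denominators cleared.\<close>

lemma mutual_info_uniform_eq_0:
  assumes fin: "finite \<Omega>" and W: "W \<subseteq> \<Omega>" "W \<noteq> {}"
    and indep: "\<And>x y. card W * card {\<omega> \<in> W. X \<omega> = x \<and> Y \<omega> = y} =
      card {\<omega> \<in> W. X \<omega> = x} * card {\<omega> \<in> W. Y \<omega> = y}"
  shows "mutual_info (uniform_measure (uniform_count_measure \<Omega>) W) X Y = 0"
proof -
  let ?C = "uniform_count_measure \<Omega>" and ?M = "uniform_measure (uniform_count_measure \<Omega>) W"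
  have \<Omega>: "\<Omega> \<noteq> {}" and finW: "finite W"
    using W fin by (auto dest: finite_subset)
  interpret prob_space ?C
    using fin \<Omega> by (rule prob_space_uniform_count_measure)
  have cW: "0 < card W" and c\<Omega>: "0 < card \<Omega>"
    using W finW \<Omega> fin by (auto simp: card_gt_0_iff)
  have mW: "measure ?C W = card W / card \<Omega>"
    using fin W by (simp add: measure_uniform_count_measure)
  have eW: "emeasure ?C W \<noteq> 0"
    using mW cW c\<Omega> by (simp add: emeasure_eq_measure)
  have prob: "measure ?M {\<omega> \<in> \<Omega>. P \<omega>} = card {\<omega> \<in> W. P \<omega>} / card W" for P
  proof -
    have "W \<inter> {\<omega> \<in> \<Omega>. P \<omega>} = {\<omega> \<in> W. P \<omega>}" using W by auto
    moreover have "measure ?M {\<omega> \<in> \<Omega>. P \<omega>} = measure ?C (W \<inter> {\<omega> \<in> \<Omega>. P \<omega>}) / measure ?C W"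
      using eW by (intro measure_uniform_measure) (auto simp: sets_uniform_count_measure)
    moreover have "measure ?C {\<omega> \<in> W. P \<omega>} = card {\<omega> \<in> W. P \<omega>} / card \<Omega>"
      using fin W by (intro measure_uniform_count_measure) auto
    ultimately show ?thesis
      using c\<Omega> by (simp add: mW)
  qed
  show ?thesis
  proof (rule mutual_info_eq_0)
    show "prob_space ?M"
      using eW by (intro prob_space_uniform_measure) auto
    show "sets ?M = Pow (space ?M)" "finite (space ?M)"
      using fin by (simp_all add: sets_uniform_count_measure space_uniform_count_measure)
    fix x y
    have "real (card W) * card {\<omega> \<in> W. X \<omega> = x \<and> Y \<omega> = y} =
        real (card {\<omega> \<in> W. X \<omega> = x}) * card {\<omega> \<in> W. Y \<omega> = y}"
      by (simp only: of_nat_mult[symmetric] indep)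
    then show "measure ?M {\<omega> \<in> space ?M. X \<omega> = x \<and> Y \<omega> = y} =
        measure ?M {\<omega> \<in> space ?M. X \<omega> = x} * measure ?M {\<omega> \<in> space ?M. Y \<omega> = y}"
      using cW by (simp add: space_uniform_count_measure prob field_simps)
  qed
qed

lemma card_fibres_indep:
  assumes fin: "finite W"
    and trans: "\<And>y y'. y \<in> Y ` W \<Longrightarrow> y' \<in> Y ` W \<Longrightarrow>
      \<exists>\<tau>. inj_on \<tau> {\<omega> \<in> W. Y \<omega> = y} \<and>
        (\<forall>\<omega>\<in>W. Y \<omega> = y \<longrightarrow> \<tau> \<omega> \<in> W \<and> X (\<tau> \<omega>) = X \<omega> \<and> Y (\<tau> \<omega>) = y')"
  shows "card W * card {\<omega> \<in> W. X \<omega> = x \<and> Y \<omega> = y} =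
    card {\<omega> \<in> W. X \<omega> = x} * card {\<omega> \<in> W. Y \<omega> = y}"
proof (cases "y \<in> Y ` W")
  case False
  then have "{\<omega> \<in> W. X \<omega> = x \<and> Y \<omega> = y} = {}" "{\<omega> \<in> W. Y \<omega> = y} = {}" by auto
  then show ?thesis by (simp only: card.empty mult_0_right)
next
  case y: True
  have le: "card {\<omega> \<in> W. P (X \<omega>) \<and> Y \<omega> = a} \<le> card {\<omega> \<in> W. P (X \<omega>) \<and> Y \<omega> = b}"
    if ab: "a \<in> Y ` W" "b \<in> Y ` W" for P a b
  proof -
    from trans[OF ab] obtain \<tau> where inj: "inj_on \<tau> {\<omega> \<in> W. Y \<omega> = a}"
      and \<tau>: "\<forall>\<omega>\<in>W. Y \<omega> = a \<longrightarrow> \<tau> \<omega> \<in> W \<and> X (\<tau> \<omega>) = X \<omega> \<and> Y (\<tau> \<omega>) = b" by blast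
    show ?thesis
    proof (rule card_inj_on_le)
      show "inj_on \<tau> {\<omega> \<in> W. P (X \<omega>) \<and> Y \<omega> = a}"
        by (rule inj_on_subset[OF inj]) auto
    qed (use \<tau> fin in auto)
  qed
  have count: "card {\<omega> \<in> W. P (X \<omega>)} = card (Y ` W) * card {\<omega> \<in> W. P (X \<omega>) \<and> Y \<omega> = y}" for P
  proof -
    have "card {\<omega> \<in> W. P (X \<omega>)} = card (\<Union>b\<in>Y ` W. {\<omega> \<in> W. P (X \<omega>) \<and> Y \<omega> = b})"
      by (rule arg_cong[where f = card]) auto
    also have "\<dots> = (\<Sum>b\<in>Y ` W. card {\<omega> \<in> W. P (X \<omega>) \<and> Y \<omega> = b})"
      using fin by (intro card_UN_disjoint) auto
    also have "\<dots> = (\<Sum>b\<in>Y ` W. card {\<omega> \<in> W. P (X \<omega>) \<and> Y \<omega> = y})"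
      using y by (intro sum.cong refl antisym le)
    finally show ?thesis by simp
  qed
  show ?thesis
    using count[of "\<lambda>_. True"] count[of "\<lambda>a. a = x"] by simp
qed

section \<open>A combinatorial criterion for complete security\<close>

lemma finite_spir_outcomes:
  assumes "spir_protocol n f P"
  shows "finite ((\<Pi>\<^sub>E i\<in>{1..f}. file_set P) \<times> seed_set P \<times> {1..f} \<times> user_rand_set P)"
  using assms by (auto simp: spir_protocol_def intro!: finite_PiE)

lemma arg_max_on_eqI:
  fixes L :: "'a \<Rightarrow> 'b :: linorder"
  assumes "x \<in> S" "\<And>y. y \<in> S \<Longrightarrow> y \<noteq> x \<Longrightarrow> L y < L x"
  shows "arg_max_on L S = x"
  unfolding arg_max_on_def arg_max_def
proof (rule some_equality)
  show "is_arg_max L (\<lambda>y. y \<in> S) x"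
    using assms by (auto simp: is_arg_max_linorder intro: less_imp_le)
  show "y = x" if "is_arg_max L (\<lambda>y. y \<in> S) y" for y
    using that assms by (auto simp: is_arg_max_def)
qed

text \<open>If the answers of \<open>A\<close> determine the requested file, every wrong file has
  likelihood zero, whereas the true one has positive likelihood. The maximizer is then unique, so
  tie-breaking is irrelevant.\<close>

lemma spir_correctI:
  fixes P :: "('m, 'u, 'r, 't, 'q, 'd) spir"
  assumes P: "spir_protocol n f P"
    and dec: "\<And>A k r m m' u u'. A \<in> \<AA> \<Longrightarrow> k \<in> {1..f} \<Longrightarrow> r \<in> user_rand_set P \<Longrightarrow>
      m \<in> {1..f} \<rightarrow>\<^sub>E file_set P \<Longrightarrow> m' \<in> {1..f} \<rightarrow>\<^sub>E file_set P \<Longrightarrow>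
      u \<in> seed_set P \<Longrightarrow> u' \<in> seed_set P \<Longrightarrow>
      \<forall>j\<in>A. rv_D P (m, u, k, r) j = rv_D P (m', u', k, r) j \<Longrightarrow> m k = m' k"
  shows "spir_correct \<AA> f P"
  unfolding spir_correct_def
proof (intro ballI)
  fix r k A assume r: "r \<in> user_rand_set P" and k: "k \<in> {1..f}" and A: "A \<in> \<AA>"
  let ?\<Omega> = "({1..f} \<rightarrow>\<^sub>E file_set P) \<times> seed_set P \<times> {1..f} \<times> user_rand_set P"
  let ?S = "spir_space f P"
  have fin: "finite ?\<Omega>" by (rule finite_spir_outcomes[OF P])
  have space: "space ?S = ?\<Omega>" by (simp add: spir_space_def space_uniform_count_measure)
  have meas: "measure ?S E = card E / card ?\<Omega>" if "E \<subseteq> ?\<Omega>" for E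
    unfolding spir_space_def using fin that by (rule measure_uniform_count_measure)
  have ml: "ml_decoder f P A k r (restrict (rv_D P \<omega>) A) = rv_M \<omega> k"
    if \<omega>: "\<omega> \<in> ?\<Omega>" "rv_K \<omega> = k" "rv_R \<omega> = r" for \<omega>
  proof -
    let ?L = "\<lambda>m. \<P>(\<omega>' in ?S. restrict (rv_D P \<omega>') A = restrict (rv_D P \<omega>) A
      \<bar> rv_M \<omega>' k = m \<and> rv_K \<omega>' = k \<and> rv_R \<omega>' = r)"
    have zero: "?L m = 0" if "m \<noteq> rv_M \<omega> k" for m
    proof -
      have "{\<omega>' \<in> space ?S. restrict (rv_D P \<omega>') A = restrict (rv_D P \<omega>) A \<and>
          rv_M \<omega>' k = m \<and> rv_K \<omega>' = k \<and> rv_R \<omega>' = r} = {}" (is "?E = {}")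
      proof (rule ccontr)
        assume "?E \<noteq> {}"
        then obtain \<omega>' where \<omega>': "\<omega>' \<in> ?E" by blast
        obtain m1 u1 where 1: "\<omega> = (m1, u1, k, r)" using \<omega>(2,3) by (cases \<omega>) auto
        obtain m2 u2 where 2: "\<omega>' = (m2, u2, k, r)" using \<omega>' by (cases \<omega>') auto
        have "\<forall>j\<in>A. rv_D P \<omega>' j = rv_D P \<omega> j"
        proof
          fix j assume "j \<in> A"
          have "restrict (rv_D P \<omega>') A = restrict (rv_D P \<omega>) A" using \<omega>' by simp
          then have "restrict (rv_D P \<omega>') A j = restrict (rv_D P \<omega>) A j" by simp
          then show "rv_D P \<omega>' j = rv_D P \<omega> j" using \<open>j \<in> A\<close> by simp
        qed
        then have "m2 k = m1 k"
          using \<omega>(1) \<omega>' A k r unfolding 1 2 space by (intro dec[of A k r m2 m1 u2 u1]) auto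
        then show False using that \<omega>' 1 2 by simp
      qed
      then show ?thesis unfolding cond_prob_def by (simp only: measure_empty div_0)
    qed
    \<comment> \<open>The outcome \<open>\<omega>\<close> itself witnesses that each event it
      satisfies is non-empty, which suffices in a uniform space.\<close>
    have pos: "0 < measure ?S {\<omega>' \<in> space ?S. Q \<omega>'}" if "Q \<omega>" for Q
    proof -
      have "{\<omega>' \<in> ?\<Omega>. Q \<omega>'} \<noteq> {}" "?\<Omega> \<noteq> {}" using \<omega> that by blast+
      moreover have "finite {\<omega>' \<in> ?\<Omega>. Q \<omega>'}" using fin by simp
      ultimately have "0 < card {\<omega>' \<in> ?\<Omega>. Q \<omega>'}" "0 < card ?\<Omega>"
        using fin by (simp_all only: card_gt_0_iff simp_thms)
      moreover have "measure ?S {\<omega>' \<in> ?\<Omega>. Q \<omega>'} = card {\<omega>' \<in> ?\<Omega>. Q \<omega>'} / card ?\<Omega>"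
        by (rule meas) auto
      ultimately show ?thesis
        unfolding space by (simp only: divide_pos_pos of_nat_0_less_iff)
    qed
    have "0 < ?L (rv_M \<omega> k)"
      unfolding cond_prob_def using \<omega> by (intro divide_pos_pos pos) auto
    moreover have "rv_M \<omega> k \<in> file_set P"
      using \<omega> k by (cases \<omega>) auto
    ultimately show ?thesis
      unfolding ml_decoder_def by (intro arg_max_on_eqI) (simp_all only: zero simp_thms)
  qed
  have "{\<omega> \<in> space ?S. ml_decoder f P A k r (restrict (rv_D P \<omega>) A) \<noteq> rv_M \<omega> k \<and>
      rv_K \<omega> = k \<and> rv_R \<omega> = r} = {}"
    using ml unfolding space by blast
  then show "\<P>(\<omega> in ?S. ml_decoder f P A k r (restrict (rv_D P \<omega>) A) \<noteq> rv_M \<omega> k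
      \<bar> rv_K \<omega> = k \<and> rv_R \<omega> = r) = 0"
    unfolding cond_prob_def by (simp only: measure_empty div_0)
qed

text \<open>The map on seeds hides a change of the files other than the \<open>k\<close>-th from all
  servers' answers. Combined with that change, it transports one fibre of the other files into
  another while fixing the answers, as the counting criterion demands.\<close>

lemma server_secretI:
  fixes P :: "('m, 'u, 'r, 't, 'q, 'd) spir"
  assumes P: "spir_protocol n f P"
    and sim: "\<And>k r m m'. k \<in> {1..f} \<Longrightarrow> r \<in> user_rand_set P \<Longrightarrow>
      m \<in> {1..f} \<rightarrow>\<^sub>E file_set P \<Longrightarrow> m' \<in> {1..f} \<rightarrow>\<^sub>E file_set P \<Longrightarrow> m k = m' k \<Longrightarrow>
      \<exists>\<pi>. inj_on \<pi> (seed_set P) \<and> (\<forall>u\<in>seed_set P. \<pi> u \<in> seed_set P \<and>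
        (\<forall>j\<in>{1..n}. rv_D P (m', \<pi> u, k, r) j = rv_D P (m, u, k, r) j))"
  shows "server_secret n f P"
  unfolding server_secret_def
proof (intro ballI)
  fix r k assume r: "r \<in> user_rand_set P" and k: "k \<in> {1..f}"
  let ?F = "{1..f} \<rightarrow>\<^sub>E file_set P" and ?U = "seed_set P"
  let ?\<Omega> = "?F \<times> ?U \<times> {1..f} \<times> user_rand_set P"
  let ?W = "{\<omega> \<in> space (spir_space f P). rv_R \<omega> = r \<and> rv_K \<omega> = k}"
  let ?X = "\<lambda>\<omega>. restrict (rv_D P \<omega>) {1..n}"
  let ?Y = "\<lambda>\<omega>. restrict (rv_M \<omega>) ({1..f} - {k})"
  have fin: "finite ?\<Omega>" by (rule finite_spir_outcomes[OF P])
  have W: "?W = ?F \<times> ?U \<times> {k} \<times> {r}"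
    using r k by (auto simp: spir_space_def space_uniform_count_measure)
  have W_sub: "?W \<subseteq> ?\<Omega>" unfolding W using r k by auto
  have "file_set P \<noteq> {}" "?U \<noteq> {}"
    using P by (auto simp: spir_protocol_def)
  then have W_ne: "?W \<noteq> {}"
    unfolding W by (simp add: PiE_eq_empty_iff)
  show "mutual_info (uniform_measure (spir_space f P) ?W) ?X ?Y = 0"
    unfolding spir_space_def
  proof (rule mutual_info_uniform_eq_0[OF fin], goal_cases)
    case 1
    then show ?case using W_sub by (simp add: spir_space_def)
  next
    case 2
    then show ?case using W_ne by (simp add: spir_space_def)
  next
    case (3 x y)
    show ?case
    proof (fold spir_space_def, unfold W, rule card_fibres_indep)
      show "finite (?F \<times> ?U \<times> {k} \<times> {r})"
        using W_sub fin unfolding W by (rule finite_subset)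
      fix y y' assume "y \<in> ?Y ` (?F \<times> ?U \<times> {k} \<times> {r})" "y' \<in> ?Y ` (?F \<times> ?U \<times> {k} \<times> {r})"
      then obtain m' where m': "m' \<in> ?F" and y': "y' = restrict m' ({1..f} - {k})" by auto
      \<comment> \<open>The files other than the \<open>k\<close>-th come from the target
        \<open>m'\<close>; the \<open>k\<close>-th is kept, because the answers reveal it.\<close>
      define c where "c m = m'(k := m k)" for m :: "nat \<Rightarrow> 'm"
      have c: "c m \<in> ?F" if "m \<in> ?F" for m
        using m' that k by (auto simp: c_def PiE_iff extensional_def)
      have "\<exists>\<pi>. inj_on \<pi> ?U \<and> (\<forall>u\<in>?U. \<pi> u \<in> ?U \<and>
          (\<forall>j\<in>{1..n}. rv_D P (c m, \<pi> u, k, r) j = rv_D P (m, u, k, r) j))" if "m \<in> ?F" for m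
        using that c[OF that] by (intro sim k r) (auto simp: c_def)
      then obtain \<pi> where inj: "\<And>m. m \<in> ?F \<Longrightarrow> inj_on (\<pi> m) ?U"
        and \<pi>: "\<And>m u. m \<in> ?F \<Longrightarrow> u \<in> ?U \<Longrightarrow> \<pi> m u \<in> ?U"
        and D: "\<And>m u j. m \<in> ?F \<Longrightarrow> u \<in> ?U \<Longrightarrow> j \<in> {1..n} \<Longrightarrow>
          rv_D P (c m, \<pi> m u, k, r) j = rv_D P (m, u, k, r) j"
        by metis
      define \<tau> where "\<tau> = (\<lambda>(m, u, k :: nat, r :: 'r). (c m, \<pi> m u, k, r))"
      \<comment> \<open>\<open>\<tau>\<close> overwrites all files but the \<open>k\<close>-th, so
        it is injective only on a fibre, where the overwritten files are prescribed by
        \<open>y\<close>.\<close>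
      have "inj_on \<tau> {\<omega> \<in> ?F \<times> ?U \<times> {k} \<times> {r}. ?Y \<omega> = y}"
      proof (rule inj_onI)
        fix \<omega>1 \<omega>2
        assume "\<omega>1 \<in> {\<omega> \<in> ?F \<times> ?U \<times> {k} \<times> {r}. ?Y \<omega> = y}" "\<omega>2 \<in> {\<omega> \<in> ?F \<times> ?U \<times> {k} \<times> {r}. ?Y \<omega> = y}"
          and eq: "\<tau> \<omega>1 = \<tau> \<omega>2"
        then obtain m1 u1 m2 u2 where 1: "\<omega>1 = (m1, u1, k, r)" "m1 \<in> ?F" "u1 \<in> ?U"
          and 2: "\<omega>2 = (m2, u2, k, r)" "m2 \<in> ?F" "u2 \<in> ?U"
          and Y: "restrict m1 ({1..f} - {k}) = restrict m2 ({1..f} - {k})"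
          by auto
        from eq have c12: "c m1 = c m2" and u12: "\<pi> m1 u1 = \<pi> m2 u2" by (auto simp: \<tau>_def 1 2)
        have "m1 i = m2 i" if "i \<in> {1..f}" for i
        proof (cases "i = k")
          case True
          then show ?thesis using fun_cong[OF c12, of k] by (simp add: c_def)
        next
          case False
          then show ?thesis using fun_cong[OF Y, of i] that by simp
        qed
        then have "m1 = m2" using 1(2) 2(2) by (rule PiE_ext[rotated 2])
        then show "\<omega>1 = \<omega>2" using u12 inj[OF 1(2)] 1 2 by (auto dest: inj_onD)
      qed
      moreover have "\<forall>\<omega>\<in>?F \<times> ?U \<times> {k} \<times> {r}. ?Y \<omega> = y \<longrightarrow>
          \<tau> \<omega> \<in> ?F \<times> ?U \<times> {k} \<times> {r} \<and> ?X (\<tau> \<omega>) = ?X \<omega> \<and> ?Y (\<tau> \<omega>) = y'"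
      proof (intro ballI impI)
        fix \<omega> assume "\<omega> \<in> ?F \<times> ?U \<times> {k} \<times> {r}"
        then obtain m u where \<omega>: "\<omega> = (m, u, k, r)" "m \<in> ?F" "u \<in> ?U" by auto
        have "?X (\<tau> \<omega>) = ?X \<omega>"
          unfolding \<omega>(1) \<tau>_def prod.case using D[OF \<omega>(2,3)] by (rule restrict_ext)
        moreover have "?Y (\<tau> \<omega>) = y'"
          by (auto simp: \<omega>(1) \<tau>_def y' c_def)
        ultimately show "\<tau> \<omega> \<in> ?F \<times> ?U \<times> {k} \<times> {r} \<and> ?X (\<tau> \<omega>) = ?X \<omega> \<and> ?Y (\<tau> \<omega>) = y'"
          using c[OF \<omega>(2)] \<pi>[OF \<omega>(2,3)] by (simp add: \<omega>(1) \<tau>_def)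
      qed
      ultimately show "\<exists>\<tau>. inj_on \<tau> {\<omega> \<in> ?F \<times> ?U \<times> {k} \<times> {r}. ?Y \<omega> = y} \<and>
          (\<forall>\<omega>\<in>?F \<times> ?U \<times> {k} \<times> {r}. ?Y \<omega> = y \<longrightarrow>
            \<tau> \<omega> \<in> ?F \<times> ?U \<times> {k} \<times> {r} \<and> ?X (\<tau> \<omega>) = ?X \<omega> \<and> ?Y (\<tau> \<omega>) = y')"
        by blast
    qed
  qed
qed

text \<open>Re-randomizing the user by \<open>\<sigma>\<close> hides a change of the requested index
  from the servers in \<open>B\<close>. This transports the outcomes with index \<open>k\<close>
  into those with index \<open>k'\<close> without altering the queries to \<open>B\<close>.\<close>

lemma user_secretI:
  fixes P :: "('m, 'u, 'r, 't, 'q, 'd) spir"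
  assumes P: "spir_protocol n f P" and f: "f \<ge> 1"
    and sim: "\<And>B k k'. B \<in> \<BB> \<Longrightarrow> k \<in> {1..f} \<Longrightarrow> k' \<in> {1..f} \<Longrightarrow>
      \<exists>\<sigma>. inj_on \<sigma> (user_rand_set P) \<and> (\<forall>r\<in>user_rand_set P. \<sigma> r \<in> user_rand_set P \<and>
        (\<forall>j\<in>B. query_map P (k', \<sigma> r) j = query_map P (k, r) j))"
  shows "user_secret \<BB> f P"
  unfolding user_secret_def
proof
  fix B assume B: "B \<in> \<BB>"
  let ?F = "{1..f} \<rightarrow>\<^sub>E file_set P"
  let ?\<Omega> = "?F \<times> seed_set P \<times> {1..f} \<times> user_rand_set P"
  let ?Q = "\<lambda>\<omega>. restrict (rv_Q P \<omega>) B"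
  have fin: "finite ?\<Omega>" by (rule finite_spir_outcomes[OF P])
  have "file_set P \<noteq> {}" "seed_set P \<noteq> {}" "user_rand_set P \<noteq> {}"
    using P by (auto simp: spir_protocol_def)
  then have ne: "?\<Omega> \<noteq> {}"
    using f by (simp add: PiE_eq_empty_iff)
  \<comment> \<open>The index plays the part of \<open>Y\<close> here, as it is what the transport
    moves; the symmetry of the counting identity restores the order of the arguments below.\<close>
  have count: "card ?\<Omega> * card {\<omega> \<in> ?\<Omega>. ?Q \<omega> = x \<and> rv_K \<omega> = y} =
      card {\<omega> \<in> ?\<Omega>. ?Q \<omega> = x} * card {\<omega> \<in> ?\<Omega>. rv_K \<omega> = y}" for x y
  proof (rule card_fibres_indep[OF fin])
    fix k k' assume "k \<in> rv_K ` ?\<Omega>" "k' \<in> rv_K ` ?\<Omega>"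
    then have k: "k \<in> {1..f}" and k': "k' \<in> {1..f}" by auto
    from sim[OF B k k'] obtain \<sigma> where inj: "inj_on \<sigma> (user_rand_set P)"
      and \<sigma>: "\<And>r. r \<in> user_rand_set P \<Longrightarrow> \<sigma> r \<in> user_rand_set P"
      and Q: "\<And>r j. r \<in> user_rand_set P \<Longrightarrow> j \<in> B \<Longrightarrow>
        query_map P (k', \<sigma> r) j = query_map P (k, r) j"
      by blast
    define \<tau> :: "('m, 'u, 'r) outcome \<Rightarrow> ('m, 'u, 'r) outcome"
      where "\<tau> = (\<lambda>(m, u, _, r). (m, u, k', \<sigma> r))"
    have "inj_on \<tau> {\<omega> \<in> ?\<Omega>. rv_K \<omega> = k}"
      using inj by (auto simp: inj_on_def \<tau>_def)
    moreover have "\<forall>\<omega>\<in>?\<Omega>. rv_K \<omega> = k \<longrightarrow> \<tau> \<omega> \<in> ?\<Omega> \<and> ?Q (\<tau> \<omega>) = ?Q \<omega> \<and> rv_K (\<tau> \<omega>) = k'"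
      using \<sigma> Q k' by (auto simp: \<tau>_def rv_Q_def intro!: restrict_ext)
    ultimately show "\<exists>\<tau>. inj_on \<tau> {\<omega> \<in> ?\<Omega>. rv_K \<omega> = k} \<and>
        (\<forall>\<omega>\<in>?\<Omega>. rv_K \<omega> = k \<longrightarrow> \<tau> \<omega> \<in> ?\<Omega> \<and> ?Q (\<tau> \<omega>) = ?Q \<omega> \<and> rv_K (\<tau> \<omega>) = k')"
      by blast
  qed
  have "mutual_info (uniform_measure (uniform_count_measure ?\<Omega>) ?\<Omega>) rv_K ?Q = 0"
    using fin ne count by (intro mutual_info_uniform_eq_0) (simp_all add: conj_commute mult.commute)
  then show "mutual_info (spir_space f P) rv_K ?Q = 0"
    unfolding spir_space_def uniform_measure_uniform_count_measure[OF fin ne] .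
qed

section \<open>Renaming finite alphabets to sets of naturals\<close>

lemma inj_on_to_nat_on_conj:
  assumes "finite S" "inj_on p S" "\<And>x. x \<in> S \<Longrightarrow> p x \<in> S"
  shows "inj_on (\<lambda>x. to_nat_on S (p (from_nat_into S x))) (to_nat_on S ` S)"
proof (rule inj_onI)
  fix a b assume "a \<in> to_nat_on S ` S" "b \<in> to_nat_on S ` S"
    and eq: "to_nat_on S (p (from_nat_into S a)) = to_nat_on S (p (from_nat_into S b))"
  then obtain x y where "a = to_nat_on S x" "x \<in> S" "b = to_nat_on S y" "y \<in> S" by blast
  then show "a = b"
    using eq assms by (simp add: countable_finite inj_on_eq_iff)
qed

text \<open>Security is invariant under bijective renaming of alphabets, so a protocol may be built
  over convenient function types and then encoded by naturals. The three security hypotheses are the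
  combinatorial criteria above, stated for the unencoded maps.\<close>

lemma ex_nat_csspir_protocol:
  fixes h :: "'u \<Rightarrow> nat \<Rightarrow> 't" and \<phi> :: "nat \<Rightarrow> 'r \<Rightarrow> nat \<Rightarrow> 'q"
    and g :: "nat \<Rightarrow> 'q \<Rightarrow> (nat \<Rightarrow> nat) \<Rightarrow> 't \<Rightarrow> 'd"
  assumes \<AA>: "\<AA> \<subseteq> Pow {1..n}" and \<BB>: "\<BB> \<subseteq> Pow {1..n}" and f: "f \<ge> 1"
    and F: "finite F" "2 \<le> card F" and U: "finite U" "U \<noteq> {}" and R: "finite R" "R \<noteq> {}"
    and dec: "\<And>A k r m m' u u'. A \<in> \<AA> \<Longrightarrow> k \<in> {1..f} \<Longrightarrow> r \<in> R \<Longrightarrow>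
      m \<in> {1..f} \<rightarrow>\<^sub>E F \<Longrightarrow> m' \<in> {1..f} \<rightarrow>\<^sub>E F \<Longrightarrow> u \<in> U \<Longrightarrow> u' \<in> U \<Longrightarrow>
      \<forall>j\<in>A. g j (\<phi> k r j) m (h u j) = g j (\<phi> k r j) m' (h u' j) \<Longrightarrow> m k = m' k"
    and server: "\<And>k r m m'. k \<in> {1..f} \<Longrightarrow> r \<in> R \<Longrightarrow>
      m \<in> {1..f} \<rightarrow>\<^sub>E F \<Longrightarrow> m' \<in> {1..f} \<rightarrow>\<^sub>E F \<Longrightarrow> m k = m' k \<Longrightarrow>
      \<exists>\<pi>. inj_on \<pi> U \<and> (\<forall>u\<in>U. \<pi> u \<in> U \<and>
        (\<forall>j\<in>{1..n}. g j (\<phi> k r j) m' (h (\<pi> u) j) = g j (\<phi> k r j) m (h u j)))"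
    and user: "\<And>B k k'. B \<in> \<BB> \<Longrightarrow> k \<in> {1..f} \<Longrightarrow> k' \<in> {1..f} \<Longrightarrow>
      \<exists>\<sigma>. inj_on \<sigma> R \<and> (\<forall>r\<in>R. \<sigma> r \<in> R \<and> (\<forall>j\<in>B. \<phi> k' (\<sigma> r) j = \<phi> k r j))"
  shows "\<exists>P :: (nat, nat, nat, nat, nat, nat) spir. csspir_protocol \<AA> \<BB> n f P"
proof -
  \<comment> \<open>The alphabets are cut down to images of finite sets, since the types themselves
    may be infinite; all servers use the same three.\<close>
  define TT where "TT = (\<lambda>(u, j). h u j) ` (U \<times> {1..n})"
  define QQ where "QQ = (\<lambda>(k, r, j). \<phi> k r j) ` ({1..f} \<times> R \<times> {1..n})"
  define DD where "DD = (\<lambda>(j, q, m, t). g j q m t) ` ({1..n} \<times> QQ \<times> ({1..f} \<rightarrow>\<^sub>E F) \<times> TT)"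
  have finT: "finite TT" and finQ: "finite QQ"
    using U R by (auto simp: TT_def QQ_def)
  then have finD: "finite DD"
    using F by (auto simp: DD_def intro!: finite_imageI finite_PiE)
  have TT: "h u j \<in> TT" if "u \<in> U" "j \<in> {1..n}" for u j
    using that by (force simp: TT_def)
  have QQ: "\<phi> k r j \<in> QQ" if "k \<in> {1..f}" "r \<in> R" "j \<in> {1..n}" for k r j
    using that by (force simp: QQ_def)
  have DD: "g j q m t \<in> DD" if "j \<in> {1..n}" "q \<in> QQ" "m \<in> {1..f} \<rightarrow>\<^sub>E F" "t \<in> TT" for j q m t
    unfolding DD_def using that by (intro image_eqI[of _ _ "(j, q, m, t)"]) auto
  \<comment> \<open>Each map decodes its arguments, applies the given map and encodes the result.
    Files are naturals already and stay as they are.\<close>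
  define P :: "(nat, nat, nat, nat, nat, nat) spir" where
    "P = \<lparr>file_set = F, seed_set = to_nat_on U ` U, user_rand_set = to_nat_on R ` R,
      share_set = (\<lambda>_. to_nat_on TT ` TT), query_set = (\<lambda>_. to_nat_on QQ ` QQ),
      answer_set = (\<lambda>_. to_nat_on DD ` DD),
      share_map = (\<lambda>u. \<lambda>j\<in>{1..n}. to_nat_on TT (h (from_nat_into U u) j)),
      query_map = (\<lambda>(k, r). \<lambda>j\<in>{1..n}. to_nat_on QQ (\<phi> k (from_nat_into R r) j)),
      answer_map = (\<lambda>j (q, m, t).
        to_nat_on DD (g j (from_nat_into QQ q) m (from_nat_into TT t)))\<rparr>"
  have sel: "file_set P = F" "seed_set P = to_nat_on U ` U" "user_rand_set P = to_nat_on R ` R"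
    by (simp_all add: P_def)
  have invs: "u \<in> U \<Longrightarrow> from_nat_into U (to_nat_on U u) = u"
    "r \<in> R \<Longrightarrow> from_nat_into R (to_nat_on R r) = r"
    "t \<in> TT \<Longrightarrow> from_nat_into TT (to_nat_on TT t) = t"
    "q \<in> QQ \<Longrightarrow> from_nat_into QQ (to_nat_on QQ q) = q" for u r t q
    using U R finT finQ by (simp_all add: countable_finite)
  have protocol: "spir_protocol n f P"
    unfolding spir_protocol_def P_def spir.simps
  proof (intro conjI ballI)
    show "(\<lambda>u. \<lambda>j\<in>{1..n}. to_nat_on TT (h (from_nat_into U u) j))
        \<in> to_nat_on U ` U \<rightarrow> ({1..n} \<rightarrow>\<^sub>E to_nat_on TT ` TT)"
      using TT by (auto simp: invs)
    show "(\<lambda>(k, r). \<lambda>j\<in>{1..n}. to_nat_on QQ (\<phi> k (from_nat_into R r) j))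
        \<in> {1..f} \<times> to_nat_on R ` R \<rightarrow> ({1..n} \<rightarrow>\<^sub>E to_nat_on QQ ` QQ)"
      using QQ by (auto simp: invs)
    fix j assume "j \<in> {1..n}"
    then show "(\<lambda>(q, m, t). to_nat_on DD (g j (from_nat_into QQ q) m (from_nat_into TT t)))
        \<in> to_nat_on QQ ` QQ \<times> ({1..f} \<rightarrow>\<^sub>E F) \<times> to_nat_on TT ` TT \<rightarrow> to_nat_on DD ` DD"
      using DD by (auto simp: invs)
  qed (use F U R finT finQ finD in auto)
  have D: "rv_D P (m, to_nat_on U u, k, to_nat_on R r) j =
      to_nat_on DD (g j (\<phi> k r j) m (h u j))"
    if "j \<in> {1..n}" "k \<in> {1..f}" "r \<in> R" "u \<in> U" for m u k r j
    using that TT QQ by (simp add: rv_D_def rv_Q_def rv_T_def P_def invs)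
  \<comment> \<open>Decoding needs this: equal encoded answers must come from equal answers.\<close>
  have injD: "inj_on (to_nat_on DD) DD"
    using finD by (simp add: inj_on_to_nat_on countable_finite)
  have "spir_correct \<AA> f P"
  proof (rule spir_correctI[OF protocol], unfold sel)
    fix A k r' m m' u' v'
    assume A: "A \<in> \<AA>" and k: "k \<in> {1..f}" and "r' \<in> to_nat_on R ` R"
      and m: "m \<in> {1..f} \<rightarrow>\<^sub>E F" "m' \<in> {1..f} \<rightarrow>\<^sub>E F"
      and "u' \<in> to_nat_on U ` U" "v' \<in> to_nat_on U ` U"
      and eq: "\<forall>j\<in>A. rv_D P (m, u', k, r') j = rv_D P (m', v', k, r') j"
    then obtain r u v where r: "r' = to_nat_on R r" "r \<in> R" and u: "u' = to_nat_on U u" "u \<in> U"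
      and v: "v' = to_nat_on U v" "v \<in> U" by blast
    show "m k = m' k"
    proof (rule dec[OF A k r(2) m u(2) v(2)], rule ballI)
      fix j assume j: "j \<in> A"
      then have jn: "j \<in> {1..n}" using A \<AA> by blast
      show "g j (\<phi> k r j) m (h u j) = g j (\<phi> k r j) m' (h v j)"
        using bspec[OF eq j] inj_onD[OF injD] jn k r u v m
        by (simp add: D DD QQ TT)
    qed
  qed
  moreover have "server_secret n f P"
  proof (rule server_secretI[OF protocol], unfold sel)
    fix k r' m m'
    assume k: "k \<in> {1..f}" and "r' \<in> to_nat_on R ` R"
      and m: "m \<in> {1..f} \<rightarrow>\<^sub>E F" "m' \<in> {1..f} \<rightarrow>\<^sub>E F" "m k = m' k"
    then obtain r where r: "r' = to_nat_on R r" "r \<in> R" by blast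
    from server[OF k r(2) m] obtain \<pi> where \<pi>: "inj_on \<pi> U" "\<And>u. u \<in> U \<Longrightarrow> \<pi> u \<in> U"
      and eq: "\<And>u j. u \<in> U \<Longrightarrow> j \<in> {1..n} \<Longrightarrow>
        g j (\<phi> k r j) m' (h (\<pi> u) j) = g j (\<phi> k r j) m (h u j)"
      by blast
    let ?\<pi> = "\<lambda>u. to_nat_on U (\<pi> (from_nat_into U u))"
    have "inj_on ?\<pi> (to_nat_on U ` U)"
      using U(1) \<pi> by (rule inj_on_to_nat_on_conj)
    moreover have "\<forall>u'\<in>to_nat_on U ` U. ?\<pi> u' \<in> to_nat_on U ` U \<and>
        (\<forall>j\<in>{1..n}. rv_D P (m', ?\<pi> u', k, r') j = rv_D P (m, u', k, r') j)"
      using \<pi> eq k r by (auto simp: invs D)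
    ultimately show "\<exists>\<pi>. inj_on \<pi> (to_nat_on U ` U) \<and> (\<forall>u\<in>to_nat_on U ` U. \<pi> u \<in> to_nat_on U ` U \<and>
        (\<forall>j\<in>{1..n}. rv_D P (m', \<pi> u, k, r') j = rv_D P (m, u, k, r') j))"
      by blast
  qed
  moreover have "user_secret \<BB> f P"
  proof (rule user_secretI[OF protocol f])
    fix B k k' assume B: "B \<in> \<BB>" and k: "k \<in> {1..f}" "k' \<in> {1..f}"
    from user[OF B k] obtain \<sigma> where \<sigma>: "inj_on \<sigma> R" "\<And>r. r \<in> R \<Longrightarrow> \<sigma> r \<in> R"
      and eq: "\<And>r j. r \<in> R \<Longrightarrow> j \<in> B \<Longrightarrow> \<phi> k' (\<sigma> r) j = \<phi> k r j"
      by blast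
    let ?\<sigma> = "\<lambda>r. to_nat_on R (\<sigma> (from_nat_into R r))"
    have "inj_on ?\<sigma> (to_nat_on R ` R)"
      using R(1) \<sigma> by (rule inj_on_to_nat_on_conj)
    moreover have "\<forall>r\<in>to_nat_on R ` R. ?\<sigma> r \<in> to_nat_on R ` R \<and>
        (\<forall>j\<in>B. query_map P (k', ?\<sigma> r) j = query_map P (k, r) j)"
      using \<sigma> eq by (auto simp: invs P_def restrict_def)
    ultimately show "\<exists>\<sigma>. inj_on \<sigma> (user_rand_set P) \<and> (\<forall>r\<in>user_rand_set P.
        \<sigma> r \<in> user_rand_set P \<and> (\<forall>j\<in>B. query_map P (k', \<sigma> r) j = query_map P (k, r) j))"
      unfolding sel by blast
  qed
  ultimately show ?thesis
    using protocol unfolding csspir_protocol_def by blast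
qed

section \<open>The protocol\<close>

text \<open>Up to currying, these are the functions into a finite type that vanish outside the
  finite set \<open>S\<close>.\<close>

lemma finite_finitely_supported:
  assumes "finite S"
  shows "finite {x :: 'a \<Rightarrow> 'b \<Rightarrow> 2. \<forall>a b. x a b \<noteq> 0 \<longrightarrow> (a, b) \<in> S}"
proof -
  have "finite {y :: 'a \<times> 'b \<Rightarrow> 2. \<forall>p. (p \<in> S \<longrightarrow> y p \<in> UNIV) \<and> (p \<notin> S \<longrightarrow> y p = 0)}"
    using assms by (rule finite_set_of_finite_funs) simp
  then have "finite (curry ` {y :: 'a \<times> 'b \<Rightarrow> 2. \<forall>p. (p \<in> S \<longrightarrow> y p \<in> UNIV) \<and> (p \<notin> S \<longrightarrow> y p = 0)})"
    by (rule finite_imageI)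
  then show ?thesis
  proof (rule rev_finite_subset, intro subsetI)
    fix x :: "'a \<Rightarrow> 'b \<Rightarrow> 2" assume "x \<in> {x. \<forall>a b. x a b \<noteq> 0 \<longrightarrow> (a, b) \<in> S}"
    then show "x \<in> curry ` {y. \<forall>p. (p \<in> S \<longrightarrow> y p \<in> UNIV) \<and> (p \<notin> S \<longrightarrow> y p = 0)}"
      by (intro image_eqI[of _ _ "case_prod x"]) auto
  qed
qed

text \<open>One additive sharing of zero for each pair \<open>(A, i)\<close>; \<open>2\<close> is the type of integers modulo 2.\<close>

definition zero_sharings :: "nat set set \<Rightarrow> 'i set \<Rightarrow> (nat set \<times> 'i \<Rightarrow> nat \<Rightarrow> 2) set" where
  "zero_sharings \<AA> I = {x. (\<forall>A i j. x (A, i) j \<noteq> 0 \<longrightarrow> A \<in> \<AA> \<and> i \<in> I \<and> j \<in> A) \<and>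
     (\<forall>A\<in>\<AA>. \<forall>i\<in>I. (\<Sum>j\<in>A. x (A, i) j) = 0)}"

lemma zero_sharings_zero: "(\<lambda>_ _. 0) \<in> zero_sharings \<AA> I"
  by (simp add: zero_sharings_def)

text \<open>Translation by a sharing of zero therefore maps the randomness space into itself; these
  translations are the bijections used for both secrecy claims.\<close>

lemma zero_sharings_add:
  assumes "x \<in> zero_sharings \<AA> I" "y \<in> zero_sharings \<AA> I"
  shows "(\<lambda>p j. x p j + y p j) \<in> zero_sharings \<AA> I"
  using assms by (auto simp: zero_sharings_def sum.distrib) (metis add_0)+

lemma finite_zero_sharings:
  assumes "finite \<AA>" "\<And>A. A \<in> \<AA> \<Longrightarrow> finite A" "finite I"
  shows "finite (zero_sharings \<AA> I)"
proof -
  have "finite ((\<AA> \<times> I) \<times> \<Union>\<AA>)" using assms by auto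
  from finite_finitely_supported[OF this] show ?thesis
    by (rule rev_finite_subset) (auto simp: zero_sharings_def)
qed

theorem corollary6:
  fixes n f :: nat and \<AA> \<BB> :: "nat set set"
  assumes "n \<ge> 1" and "access_structure n \<AA> \<BB>" and "\<AA> \<noteq> {}" and "\<BB> \<noteq> {}" and "f \<ge> 2"
  shows "\<exists>P :: (nat, nat, nat, nat, nat, nat) spir. csspir_protocol \<AA> \<BB> n f P"
proof -
  have \<AA>: "\<AA> \<subseteq> Pow {1..n}" and \<BB>: "\<BB> \<subseteq> Pow {1..n}"
    and down: "\<And>B B'. B \<in> \<BB> \<Longrightarrow> B' \<subseteq> B \<Longrightarrow> B' \<in> \<BB>" and disj: "\<AA> \<inter> \<BB> = {}"
    using assms(2) by (simp_all add: access_structure_def)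
  \<comment> \<open>Having the empty set in \<open>\<BB>\<close> excludes it from
    \<open>\<AA>\<close>, so \<open>Min A\<close> is a genuine server of each
    \<open>A \<in> \<AA>\<close>.\<close>
  have "{} \<in> \<BB>" using \<open>\<BB> \<noteq> {}\<close> down by blast
  then have ne: "A \<noteq> {}" if "A \<in> \<AA>" for A using disj that by blast
  have fin\<AA>: "finite \<AA>" using \<AA> by (rule finite_subset) simp
  have finA: "finite A" if "A \<in> \<AA>" for A using \<AA> that by (auto dest: finite_subset)
  have MinA: "Min A \<in> A" if "A \<in> \<AA>" for A using finA ne that by (intro Min_in)
  \<comment> \<open>The user needs one sharing for each coordinate of the query vector, the servers
    just one mask for each \<open>A\<close>; hence the one-element index type for
    \<open>U\<close>.\<close>
  define R where "R = zero_sharings \<AA> {1..f}"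
  define U where "U = zero_sharings \<AA> (UNIV :: unit set)"
  have finR: "finite R" and finU: "finite U"
    unfolding R_def U_def using fin\<AA> finA by (auto intro!: finite_zero_sharings)
  \<comment> \<open>This is the trivial sharing of the \<open>k\<close>-th unit vector, with all the
    weight on server \<open>Min A\<close>. Adding a sharing of zero randomizes it.\<close>
  define e :: "nat \<Rightarrow> nat set \<times> nat \<Rightarrow> nat \<Rightarrow> 2"
    where "e k = (\<lambda>(A, i) j. of_bool (A \<in> \<AA> \<and> j = Min A \<and> i = k))" for k
  define \<phi> :: "nat \<Rightarrow> (nat set \<times> nat \<Rightarrow> nat \<Rightarrow> 2) \<Rightarrow> nat \<Rightarrow> nat set \<times> nat \<Rightarrow> 2"
    where "\<phi> k r j = (\<lambda>p. r p j + e k p j)" for k r j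
  define h :: "(nat set \<times> unit \<Rightarrow> nat \<Rightarrow> 2) \<Rightarrow> nat \<Rightarrow> nat set \<Rightarrow> 2"
    where "h u j = (\<lambda>A. u (A, ()) j)" for u j
  define g :: "nat \<Rightarrow> (nat set \<times> nat \<Rightarrow> 2) \<Rightarrow> (nat \<Rightarrow> nat) \<Rightarrow> (nat set \<Rightarrow> 2) \<Rightarrow> nat set \<Rightarrow> 2"
    where "g j q m t = (\<lambda>A. if A \<in> \<AA> \<and> j \<in> A then (\<Sum>i\<in>{1..f}. q (A, i) * of_nat (m i)) + t A else 0)"
    for j q m t
  have sum_\<phi>: "(\<Sum>j\<in>A. \<Sum>i\<in>{1..f}. \<phi> k r j (A, i) * of_nat (m i)) = of_nat (m k)"
    if A: "A \<in> \<AA>" and r: "r \<in> R" and k: "k \<in> {1..f}" for A r k m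
  proof -
    have "(\<Sum>j\<in>A. \<phi> k r j (A, i)) = of_bool (i = k)" if "i \<in> {1..f}" for i
    proof -
      have "(\<Sum>j\<in>A. r (A, i) j) = 0"
        using r A that by (auto simp: R_def zero_sharings_def)
      moreover have "(\<Sum>j\<in>A. e k (A, i) j) = (\<Sum>j\<in>A. if j = Min A then of_bool (i = k) else 0)"
        using A by (intro sum.cong) (auto simp: e_def)
      ultimately show ?thesis
        using MinA[OF A] finA[OF A]
        by (simp only: \<phi>_def sum.distrib sum.delta if_True add_0_left)
    qed
    then have "(\<Sum>i\<in>{1..f}. (\<Sum>j\<in>A. \<phi> k r j (A, i)) * of_nat (m i)) =
        (\<Sum>i\<in>{1..f}. if i = k then of_nat (m i) else 0)"
      by (intro sum.cong) auto
    then show ?thesis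
      using k by (subst sum.swap) (simp add: sum_distrib_right)
  qed
  show ?thesis
  \<comment> \<open>The files are the naturals 0 and 1, on which \<open>of_nat\<close> into the
    field with two elements is injective.\<close>
  proof (rule ex_nat_csspir_protocol[where F = "{0, 1}" and U = U and R = R
        and h = h and \<phi> = \<phi> and g = g])
    show "U \<noteq> {}" "R \<noteq> {}"
      unfolding U_def R_def using zero_sharings_zero by blast+
  next
    fix A k r m m' u u'
    assume A: "A \<in> \<AA>" and k: "k \<in> {1..f}" and r: "r \<in> R"
      and m: "m \<in> {1..f} \<rightarrow>\<^sub>E {0, 1 :: nat}" "m' \<in> {1..f} \<rightarrow>\<^sub>E {0, 1 :: nat}"
      and u: "u \<in> U" "u' \<in> U"
      and eq: "\<forall>j\<in>A. g j (\<phi> k r j) m (h u j) = g j (\<phi> k r j) m' (h u' j)"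
    \<comment> \<open>Only the component \<open>A\<close> of the answers is used: there the masks
      sum to zero over \<open>A\<close>, leaving the requested file.\<close>
    have *: "(\<Sum>j\<in>A. g j (\<phi> k r j) m (h u j) A) = of_nat (m k)" if "u \<in> U" for u m
    proof -
      have "(\<Sum>j\<in>A. g j (\<phi> k r j) m (h u j) A) =
          (\<Sum>j\<in>A. (\<Sum>i\<in>{1..f}. \<phi> k r j (A, i) * of_nat (m i)) + u (A, ()) j)"
        using A by (intro sum.cong) (auto simp: g_def h_def)
      also have "\<dots> = of_nat (m k)"
        using that A by (simp add: sum.distrib sum_\<phi>[OF A r k] U_def zero_sharings_def del: One_nat_def)
      finally show ?thesis .
    qed
    have "(of_nat (m k) :: 2) = (\<Sum>j\<in>A. g j (\<phi> k r j) m (h u j) A)"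
      by (rule *[OF u(1), symmetric])
    also have "\<dots> = (\<Sum>j\<in>A. g j (\<phi> k r j) m' (h u' j) A)"
      using eq by (intro sum.cong) simp_all
    also have "\<dots> = of_nat (m' k)"
      by (rule *[OF u(2)])
    finally have "of_nat (m k) = (of_nat (m' k) :: 2)" .
    then show "m k = m' k"
      using PiE_mem[OF m(1) k] PiE_mem[OF m(2) k] by auto
  next
    fix k r m m'
    assume k: "k \<in> {1..f}" and r: "r \<in> R" and mk: "m k = (m' k :: nat)"
    \<comment> \<open>The mask shift is the difference of the unmasked answers. Its sum over
      \<open>A\<close> is \<open>of_nat (m k) - of_nat (m' k)\<close>, which vanishes by
      \<open>mk\<close>, so the shift is a sharing of zero.\<close>
    define \<delta> :: "nat set \<times> unit \<Rightarrow> nat \<Rightarrow> 2"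
      where "\<delta> = (\<lambda>(A, _) j. if A \<in> \<AA> \<and> j \<in> A then (\<Sum>i\<in>{1..f}. \<phi> k r j (A, i) * of_nat (m i)) -
        (\<Sum>i\<in>{1..f}. \<phi> k r j (A, i) * of_nat (m' i)) else 0)"
    have \<delta>: "\<delta> \<in> U"
      unfolding U_def zero_sharings_def
      using mk by (auto simp: \<delta>_def sum_subtractf sum_\<phi>[OF _ r k] simp del: One_nat_def split: if_splits)
    show "\<exists>\<pi>. inj_on \<pi> U \<and> (\<forall>u\<in>U. \<pi> u \<in> U \<and>
        (\<forall>j\<in>{1..n}. g j (\<phi> k r j) m' (h (\<pi> u) j) = g j (\<phi> k r j) m (h u j)))"
    proof (intro exI conjI ballI)
      show "inj_on (\<lambda>u p j. u p j + \<delta> p j) U"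
        by (auto simp: inj_on_def fun_eq_iff)
      fix u assume "u \<in> U"
      then show "(\<lambda>p j. u p j + \<delta> p j) \<in> U"
        using \<delta> unfolding U_def by (rule zero_sharings_add)
      fix j
      show "g j (\<phi> k r j) m' (h (\<lambda>p j. u p j + \<delta> p j) j) = g j (\<phi> k r j) m (h u j)"
        by (auto simp: g_def h_def \<delta>_def fun_eq_iff)
    qed
  next
    fix B k k' assume B: "B \<in> \<BB>" and k: "k \<in> {1..f}" "k' \<in> {1..f}"
    \<comment> \<open>If \<open>A\<close> were contained in \<open>B\<close>, downward closure would
      put \<open>A\<close> into \<open>\<BB>\<close>, contradicting disjointness.\<close>
    have "\<exists>j. j \<in> A - B" if "A \<in> \<AA>" for A
      using that down[OF B] disj by blast
    then obtain b where b: "\<And>A. A \<in> \<AA> \<Longrightarrow> b A \<in> A - B" by metis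
    \<comment> \<open>This is again a trivial sharing of the unit vector, now with its weight on a
      server \<open>b A\<close> outside \<open>B\<close>.\<close>
    define d :: "nat \<Rightarrow> nat set \<times> nat \<Rightarrow> nat \<Rightarrow> 2"
      where "d k = (\<lambda>(A, i) j. of_bool (A \<in> \<AA> \<and> j = b A \<and> i = k))" for k
    \<comment> \<open>The first bracket turns the sharing for \<open>k'\<close> into the one for
      \<open>k\<close>; the second restores zero sums over each \<open>A\<close> and vanishes on the
      servers in \<open>B\<close>.\<close>
    define \<delta> where "\<delta> p j = (e k p j - e k' p j) - (d k p j - d k' p j)" for p j
    have sum_one: "(\<Sum>j\<in>A. of_bool (j = a \<and> i = l)) = (of_bool (i = l) :: 2)"
      if "A \<in> \<AA>" "a \<in> A" for A a and i l :: nat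
    proof -
      have "(\<Sum>j\<in>A. of_bool (j = a \<and> i = l)) = (\<Sum>j\<in>A. if j = a then of_bool (i = l) else (0 :: 2))"
        by (intro sum.cong) auto
      then show ?thesis using that finA by simp
    qed
    have \<delta>: "\<delta> \<in> R"
      unfolding R_def zero_sharings_def
    proof (intro CollectI conjI allI ballI impI)
      fix A i j assume nz: "\<delta> (A, i) j \<noteq> 0"
      then show "A \<in> \<AA>" "i \<in> {1..f}" "j \<in> A"
        using k MinA b by (auto simp: \<delta>_def e_def d_def of_bool_def split: if_splits)
    next
      fix A i assume A: "A \<in> \<AA>"
      then have "b A \<in> A" using b by blast
      then show "(\<Sum>j\<in>A. \<delta> (A, i) j) = 0"
        using A MinA[OF A] by (simp add: \<delta>_def e_def d_def sum_subtractf sum_one)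
    qed
    show "\<exists>\<sigma>. inj_on \<sigma> R \<and> (\<forall>r\<in>R. \<sigma> r \<in> R \<and> (\<forall>j\<in>B. \<phi> k' (\<sigma> r) j = \<phi> k r j))"
    proof (intro exI conjI ballI)
      show "inj_on (\<lambda>r p j. r p j + \<delta> p j) R"
        by (auto simp: inj_on_def fun_eq_iff)
      fix r assume "r \<in> R"
      then show "(\<lambda>p j. r p j + \<delta> p j) \<in> R"
        using \<delta> unfolding R_def by (rule zero_sharings_add)
      fix j assume "j \<in> B"
      then have "d l p j = 0" for l p
        using b by (auto simp: d_def split: prod.split)
      then show "\<phi> k' (\<lambda>p j. r p j + \<delta> p j) j = \<phi> k r j"
        by (simp add: \<phi>_def \<delta>_def fun_eq_iff)
    qed
  qed (use \<AA> \<BB> \<open>f \<ge> 2\<close> finU finR in auto)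
qed

end
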